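(* For every positive integer $m$, $$\mathrm{forb}(m,F_{1,4})=f(m,4)\qquad\text{and}\qquad \mathrm{forb}(m,F_{3,k})=f(m,k)\ \text{ for } k=4,5,6,$$ where $f(m,k)=2\sum_{i=0}^{k-2}\binom{m-1}{i}=\binom{m-1}{k-2}+\sum_{i=0}^{k-2}\binom{m}{i}$, and the matrices $F_{1,4}$, $F_{3,k}$ are as defined in the context.
   Context: A matrix is simple if it is a $(0,1)$-matrix with no repeated columns. For a $(0,1)$-matrix $F$ and a $(0,1)$-matrix $A$, $F$ is a configuration in $A$ (written $F\prec A$) if some submatrix of $A$ is a row and column permutation of $F$. $\mathrm{Avoid}(m,F)$ is the set of all simple $m$-rowed matrices $A$ with $F\not\prec A$, and $\mathrm{forb}(m,F)=\max_{A\in\mathrm{Avoid}(m,F)}(\text{number of columns of }A)$. $K_t$ denotes the $t\times 2^t$ matrix of all $(0,1)$-columns of length $t$ (with $K_0$ the $0$-rowed matrix with one column). For simple matrices $A$ ($m_1$ rows) and $B$ ($m_2$ rows), the product $A\times B$ is the $(m_1+m_2)$-rowed matrix whose columns are all columns obtained by placing a column of $A$ on top of a column of $B$ (so it has $|A|\cdot|B|$ columns). $F_{1,4}=G_1\times K_1$ where $G_1=\begin{bmatrix}1&1&1&0\\1&0&0&1\\0&1&0&0\end{bmatrix}$ (so $F_{1,4}$ is $4\times 8$). $F_{3,k}=G_3\times K_{k-4}$ where $G_3=\begin{bmatrix}0&0&0&0&1&0&0&1\\0&0&0&1&0&1&1&0\\0&1&1&0&0&1&1&1\\1&0&1&1&1&0&1&1\end{bmatrix}$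 (so $F_{3,4}=G_3$, $F_{3,5}$ is $5\times16$, $F_{3,6}$ is $6\times 32$). *)

theory Defs
  imports "Jordan_Normal_Form.DL_Submatrix" "HOL-Combinatorics.Permutations"
begin

definition zero_one_mat :: "nat mat \<Rightarrow> bool" where
  "zero_one_mat A \<longleftrightarrow> elements_mat A \<subseteq> {0, 1}"

definition simple_mat :: "nat mat \<Rightarrow> bool" where
  "simple_mat A \<longleftrightarrow> zero_one_mat A \<and> distinct (cols A)"

definition row_col_perm :: "nat mat \<Rightarrow> nat mat \<Rightarrow> bool" where
  "row_col_perm F B \<longleftrightarrow>
     (\<exists>p q. p permutes {..<dim_row F} \<and> q permutes {..<dim_col F} \<and>
            B = mat (dim_row F) (dim_col F) (\<lambda>(i, j). F $$ (p i, q j)))"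

definition configuration_in :: "nat mat \<Rightarrow> nat mat \<Rightarrow> bool" (infix "\<prec>" 50) where
  "F \<prec> A \<longleftrightarrow> (\<exists>I J. row_col_perm F (submatrix A I J))"

definition Avoid :: "nat \<Rightarrow> nat mat \<Rightarrow> nat mat set" where
  "Avoid m F = {A. dim_row A = m \<and> simple_mat A \<and> \<not> F \<prec> A}"

definition forb :: "nat \<Rightarrow> nat mat \<Rightarrow> nat" where
  "forb m F = Max (dim_col ` Avoid m F)"

text \<open>Column \<open>j\<close> of \<open>K t\<close> lists the binary digits of \<open>j\<close>, so that every
  \<open>(0,1)\<close>-column of length \<open>t\<close> occurs exactly once.\<close>

definition K :: "nat \<Rightarrow> nat mat" where
  "K t = mat t (2 ^ t) (\<lambda>(i, j). j div 2 ^ i mod 2)"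

text \<open>Column \<open>a * dim_col B + b\<close> of the product is column \<open>a\<close> of \<open>A\<close> on top of
  column \<open>b\<close> of \<open>B\<close>.\<close>

definition mat_product :: "nat mat \<Rightarrow> nat mat \<Rightarrow> nat mat" (infixl "\<otimes>\<^sub>c" 70) where
  "A \<otimes>\<^sub>c B = mat (dim_row A + dim_row B) (dim_col A * dim_col B)
     (\<lambda>(i, j). if i < dim_row A then A $$ (i, j div dim_col B)
               else B $$ (i - dim_row A, j mod dim_col B))"

definition G1 :: "nat mat" where
  "G1 = mat_of_rows_list 4
     [[1, 1, 1, 0],
      [1, 0, 0, 1],
      [0, 1, 0, 0]]"

definition G3 :: "nat mat" where
  "G3 = mat_of_rows_list 8
     [[0, 0, 0, 0, 1, 0, 0, 1],
      [0, 0, 0, 1, 0, 1, 1, 0],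
      [0, 1, 1, 0, 0, 1, 1, 1],
      [1, 0, 1, 1, 1, 0, 1, 1]]"

definition F14 :: "nat mat" where
  "F14 = G1 \<otimes>\<^sub>c K 1"

text \<open>Intended for \<open>k \<ge> 4\<close>.\<close>

definition F3 :: "nat \<Rightarrow> nat mat" where
  "F3 k = G3 \<otimes>\<^sub>c K (k - 4)"

text \<open>Intended for \<open>m \<ge> 1\<close> and \<open>k \<ge> 2\<close>.\<close>

definition f_bound :: "nat \<Rightarrow> nat \<Rightarrow> nat" where
  "f_bound m k = 2 * (\<Sum>i = 0..k - 2. (m - 1) choose i)"

lemma F3_4: "F3 4 = G3"
  by (rule eq_matI) (auto simp: F3_def mat_product_def K_def)

lemma distinct_cols_K: "distinct (cols (K t))"
proof -
  have "j = j'" if j: "j < 2 ^ t" "j' < 2 ^ t" and e: "col (K t) j = col (K t) j'" for j j'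
  proof -
    have d: "j div 2 ^ i mod 2 = j' div 2 ^ i mod 2" if "i < t" for i
    proof -
      have "col (K t) j $ i = col (K t) j' $ i" using e by simp
      then show ?thesis using that j by (simp add: K_def)
    qed
    have "take_bit t j = take_bit t j'"
    proof (rule bit_eqI)
      fix n
      show "bit (take_bit t j) n = bit (take_bit t j') n"
        using d[of n] unfolding bit_take_bit_iff by (auto simp: bit_iff_odd odd_iff_mod_2_eq_one)
    qed
    then show ?thesis using j by (simp add: take_bit_nat_eq_self)
  qed
  then show ?thesis
    by (auto simp: distinct_conv_nth cols_def K_def)
qed

text \<open>The maximum defining \<open>forb\<close> is taken over a finite set, which is nonempty whenever \<open>F\<close>
  has a column.\<close>

lemma simple_mat_dim_col_le:
  assumes "simple_mat A"
  shows "dim_col A \<le> 2 ^ dim_row A"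
proof -
  let ?S = "vec_of_list ` {xs. set xs \<subseteq> {0, 1::nat} \<and> length xs = dim_row A}"
  have fin: "finite {xs. set xs \<subseteq> {0, 1::nat} \<and> length xs = dim_row A}"
    by (rule finite_lists_length_eq) simp
  have "set (cols A) \<subseteq> ?S"
  proof
    fix v assume "v \<in> set (cols A)"
    then obtain j where j: "j < dim_col A" "v = col A j"
      by (auto simp: cols_def)
    have "v $ i \<in> {0, 1}" if "i < dim_row A" for i
      using assms j that unfolding simple_mat_def zero_one_mat_def
      by (auto intro!: elements_matI[of A "dim_row A" "dim_col A" i j])
    then have "set (list_of_vec v) \<subseteq> {0, 1}"
      using j by (fastforce simp: set_list_of_vec vec_set_def)
    moreover have "length (list_of_vec v) = dim_row A"
      using j by simp
    moreover have "v = vec_of_list (list_of_vec v)"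
      by (simp add: vec_list)
    ultimately show "v \<in> ?S" by blast
  qed
  then have "card (set (cols A)) \<le> card ?S"
    using fin by (intro card_mono) auto
  also have "\<dots> \<le> card {xs. set xs \<subseteq> {0, 1::nat} \<and> length xs = dim_row A}"
    by (rule card_image_le[OF fin])
  also have "\<dots> = 2 ^ dim_row A"
    by (subst card_lists_length_eq) (auto simp: numeral_2_eq_2)
  finally show ?thesis
    using assms by (simp add: simple_mat_def distinct_card)
qed

lemma finite_dim_col_Avoid: "finite (dim_col ` Avoid m F)"
proof (rule finite_subset)
  show "dim_col ` Avoid m F \<subseteq> {..2 ^ m}"
    by (auto simp: Avoid_def dest: simple_mat_dim_col_le)
qed simp

lemma Avoid_nonempty:
  assumes "dim_col F > 0"
  shows "Avoid m F \<noteq> {}"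
proof -
  have "mat m 0 (\<lambda>_. 0) \<in> Avoid m F"
    using assms
    by (auto simp: Avoid_def simple_mat_def zero_one_mat_def configuration_in_def row_col_perm_def
        elements_mat_def cols_def submatrix_def dest: arg_cong[where f = dim_col])
  then show ?thesis by blast
qed

end

theory Submission
  imports Defs
begin

text \<open>
  Upper bound: split off a row \<open>r\<close>. The columns of \<open>A\<close> restricted to the other rows, counted
  without repetition, still avoid \<open>F\<close>, and the set \<open>C\<close> of restrictions that occur with both
  entries in row \<open>r\<close> avoids every configuration obtained from \<open>F\<close> by deleting a row. Since
  \<open>f(m,k) = f(m-1,k) + f(m-1,k-1)\<close>, it suffices to bound \<open>C\<close>. Deleting rows leads from
  \<open>G\<^sub>3 \<times> K\<^sub>t\<close> down to \<open>G\<^sub>3\<close>, then to two \<open>3 \<times> 5\<close> configurations, and from \<open>G\<^sub>1 \<times> K\<^sub>1\<close> to \<open>G\<^sub>1\<close>;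
  one more deletion yields all simple \<open>2 \<times> 3\<close> configurations, and a simple matrix with three
  columns contains one of those.

  Lower bound: take all columns whose entry changes at most \<open>k - 2\<close> times from one row to the
  next. On any \<open>k\<close> rows they miss both alternating columns, whereas every row permutation of the
  given matrices contains one column of each complementary pair with \<open>\<lfloor>k/2\<rfloor>\<close> and \<open>\<lceil>k/2\<rceil>\<close> ones.
\<close>

section \<open>Configurations in set families\<close>

definition trace :: "'a list \<Rightarrow> 'a set \<Rightarrow> bool list" where
  "trace rs A = map (\<lambda>r. r \<in> A) rs"

text \<open>The order of \<open>rs\<close> absorbs row permutations. A set of columns forgets their
  order, and loses nothing when the configuration is a simple matrix.\<close>

definition config :: "'a set \<Rightarrow> 'a set set \<Rightarrow> bool list set \<Rightarrow> bool" where
  "config R \<A> Q \<longleftrightarrow> (\<exists>rs. distinct rs \<and> set rs \<subseteq> R \<and> Q \<subseteq> trace rs ` \<A>)"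

definition standard_part :: "'a \<Rightarrow> 'a set set \<Rightarrow> 'a set set" where
  "standard_part r \<A> = {A \<in> \<A>. r \<notin> A \<and> insert r A \<in> \<A>}"

text \<open>\<open>A0\<close> and \<open>A1\<close> are the columns with entry 0 and 1 in row
  \<open>r\<close>, restricted to the other rows. Their union is the image, their intersection is
  the standard part, and inclusion-exclusion gives the count.\<close>

lemma card_standard_decomposition:
  assumes "finite \<A>"
  shows "card \<A> = card ((\<lambda>A. A - {r}) ` \<A>) + card (standard_part r \<A>)"
proof -
  define A0 where "A0 = {A \<in> \<A>. r \<notin> A}"
  define A1 where "A1 = (\<lambda>A. A - {r}) ` {A \<in> \<A>. r \<in> A}"
  have fin: "finite A0" "finite A1" using assms by (auto simp: A0_def A1_def)
  have "card A1 = card {A \<in> \<A>. r \<in> A}"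
    unfolding A1_def by (intro card_image inj_onI) (metis insert_Diff mem_Collect_eq)
  moreover have "card \<A> = card A0 + card {A \<in> \<A>. r \<in> A}"
  proof -
    have "\<A> = A0 \<union> {A \<in> \<A>. r \<in> A}" "A0 \<inter> {A \<in> \<A>. r \<in> A} = {}" by (auto simp: A0_def)
    then show ?thesis using assms card_Un_disjoint by (metis finite_Un)
  qed
  moreover have "(\<lambda>A. A - {r}) ` \<A> = A0 \<union> A1"
  proof -
    have "\<A> = A0 \<union> {A \<in> \<A>. r \<in> A}" by (auto simp: A0_def)
    moreover have "(\<lambda>A. A - {r}) ` A0 = A0" by (force simp: A0_def)
    moreover have "(\<lambda>A. A - {r}) ` (A0 \<union> {A \<in> \<A>. r \<in> A}) = (\<lambda>A. A - {r}) ` A0 \<union> A1"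
      unfolding A1_def by (rule image_Un)
    ultimately show ?thesis by simp
  qed
  moreover have "standard_part r \<A> = A0 \<inter> A1"
  proof (intro equalityI subsetI)
    fix A assume A: "A \<in> standard_part r \<A>"
    then have "A = insert r A - {r}" by (auto simp: standard_part_def)
    then show "A \<in> A0 \<inter> A1" using A unfolding standard_part_def A0_def A1_def by blast
  next
    fix A assume "A \<in> A0 \<inter> A1"
    then show "A \<in> standard_part r \<A>"
      unfolding standard_part_def A0_def A1_def by (auto simp: insert_absorb)
  qed
  ultimately show ?thesis using card_Un_Int[OF fin] by simp
qed

lemma config_delete_row:
  assumes "config (R - {r}) ((\<lambda>A. A - {r}) ` \<A>) Q"
  shows "config R \<A> Q"
proof -
  obtain rs where rs: "distinct rs" "set rs \<subseteq> R - {r}" "Q \<subseteq> trace rs ` (\<lambda>A. A - {r}) ` \<A>"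
    using assms by (auto simp: config_def)
  have "trace rs (A - {r}) = trace rs A" for A
    using rs(2) by (auto simp: trace_def)
  then show ?thesis using rs unfolding config_def image_image by auto
qed

text \<open>Every column of the standard part extends to row \<open>r\<close> with either entry, so
  row \<open>r\<close> can be inserted at position \<open>i\<close> with any prescribed pattern.
  Thus a configuration with row \<open>i\<close> deleted in the standard part forces the whole
  configuration in \<open>\<A>\<close>.\<close>

lemma config_insert_row:
  assumes C: "config (R - {r}) (standard_part r \<A>) Q'" and r: "r \<in> R"
    and Q: "\<forall>q \<in> Q. i < length q \<and> take i q @ drop (Suc i) q \<in> Q'"
  shows "config R \<A> Q"
proof -
  obtain rs where rs: "distinct rs" "set rs \<subseteq> R - {r}" "Q' \<subseteq> trace rs ` standard_part r \<A>"
    using C by (auto simp: config_def)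
  define ss where "ss = take i rs @ r # drop i rs"
  have set: "set (take i rs) \<union> set (drop i rs) = set rs"
    by (metis append_take_drop_id set_append)
  have "set (take i rs) \<inter> set (drop i rs) = {}"
    using rs(1) by (simp add: set_take_disj_set_drop_if_distinct)
  then have "distinct ss" "set ss \<subseteq> R"
    using set rs(1,2) r unfolding ss_def by auto
  moreover have "q \<in> trace ss ` \<A>" if "q \<in> Q" for q
  proof -
    have i: "i < length q" and "take i q @ drop (Suc i) q \<in> Q'" using Q that by auto
    then obtain A where A: "A \<in> standard_part r \<A>" "take i q @ drop (Suc i) q = trace rs A"
      using rs(3) by auto
    \<comment> \<open>Of the two extensions of \<open>A\<close>, the one whose entry in row
      \<open>r\<close> is the deleted entry of \<open>q\<close>.\<close>
    define B where "B = (if q ! i then insert r A else A)"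
    have B: "r \<in> B \<longleftrightarrow> q ! i" "B \<in> \<A>"
      using A(1) unfolding B_def standard_part_def by auto
    have "trace (take i rs) B = trace (take i rs) A" "trace (drop i rs) B = trace (drop i rs) A"
      using set rs(2) unfolding B_def trace_def by auto
    moreover have "take i q = trace (take i rs) A"
      using i arg_cong[OF A(2), of "take i"] by (simp add: trace_def take_map)
    moreover have "drop (Suc i) q = trace (drop i rs) A"
      using i arg_cong[OF A(2), of "drop i"] by (simp add: trace_def drop_map)
    moreover have "trace ss B = trace (take i rs) B @ (r \<in> B) # trace (drop i rs) B"
      by (simp add: ss_def trace_def)
    ultimately have "q = trace ss B"
      using B(1) id_take_nth_drop[OF i] by simp
    then show ?thesis using B(2) by blast
  qed
  ultimately show ?thesis unfolding config_def by blast
qed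

text \<open>Reversal is one of the permitted row permutations. On two rows it is the only nontrivial
  one, which is the case needed for \<open>G1\<close>.\<close>

lemma config_rev:
  assumes "config R \<A> Q"
  shows "config R \<A> (rev ` Q)"
proof -
  obtain rs where rs: "distinct rs" "set rs \<subseteq> R" "Q \<subseteq> trace rs ` \<A>"
    using assms by (auto simp: config_def)
  have "rev ` Q \<subseteq> rev ` trace rs ` \<A>" using rs(3) by blast
  also have "\<dots> = trace (rev rs) ` \<A>" by (simp add: image_image trace_def rev_map)
  finally have "rev ` Q \<subseteq> trace (rev rs) ` \<A>" .
  then show ?thesis using rs(1,2) unfolding config_def by (intro exI[of _ "rev rs"]) auto
qed

text \<open>The type argument fixes the ground type, which \<open>QQ\<close> and \<open>d\<close> do not determine.\<close>

definition bounded_avoiders :: "'a itself \<Rightarrow> bool list set set \<Rightarrow> nat \<Rightarrow> bool" where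
  "bounded_avoiders (TY :: 'a itself) QQ d \<longleftrightarrow>
     (\<forall>(R :: 'a set) \<A>. finite R \<longrightarrow> R \<noteq> {} \<longrightarrow> \<A> \<subseteq> Pow R \<longrightarrow> (\<forall>Q \<in> QQ. \<not> config R \<A> Q) \<longrightarrow>
       card \<A> \<le> 2 * (\<Sum>i\<le>d. (card R - 1) choose i))"

section \<open>The recursive upper bound\<close>

lemma sum_choose_Suc:
  "(\<Sum>i\<le>Suc d. Suc n choose i) = (\<Sum>i\<le>Suc d. n choose i) + (\<Sum>i\<le>d. n choose i)"
  by (induction d) auto

text \<open>Induction on the set of rows. Each member of \<open>QQ'\<close> has to contain a row
  deletion of some member of \<open>QQ\<close>, so a standard part that met \<open>QQ'\<close> would
  produce a member of \<open>QQ\<close>. The two summands of the decomposition then match the two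
  sums of \<open>sum_choose_Suc\<close>.\<close>

lemma bounded_avoiders_Suc:
  assumes bd: "bounded_avoiders TYPE('a) QQ' d"
    and child: "\<forall>Q' \<in> QQ'. \<exists>Q \<in> QQ. \<exists>i. \<forall>q \<in> Q. i < length q \<and> take i q @ drop (Suc i) q \<in> Q'"
  shows "bounded_avoiders TYPE('a) QQ (Suc d)"
  unfolding bounded_avoiders_def
proof (intro allI impI)
  fix R :: "'a set" and \<A>
  assume "finite R" "R \<noteq> {}" "\<A> \<subseteq> Pow R" "\<forall>Q \<in> QQ. \<not> config R \<A> Q"
  then show "card \<A> \<le> 2 * (\<Sum>i\<le>Suc d. (card R - 1) choose i)"
  proof (induction R arbitrary: \<A> rule: finite_ne_induct)
    case (singleton x)
    have "card \<A> \<le> card (Pow {x})" using singleton by (intro card_mono) auto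
    also have "\<dots> = 2" by (subst card_Pow) auto
    \<comment> \<open>On one row the sum reduces to its term \<open>i = 0\<close>, which is
      1.\<close>
    finally show ?case by (simp add: sum.atMost_shift del: sum.atMost_Suc)
  next
    case (insert x R)
    define n where "n = card R - 1"
    have n: "card R = Suc n" using insert.hyps by (simp add: n_def card_gt_0_iff)
    have R: "insert x R - {x} = R" using insert.hyps by simp
    have "finite \<A>" using insert.prems(1) insert.hyps(1) by (meson finite.insertI finite_Pow_iff finite_subset)
    then have "card \<A> = card ((\<lambda>A. A - {x}) ` \<A>) + card (standard_part x \<A>)"
      by (rule card_standard_decomposition)
    moreover have "card ((\<lambda>A. A - {x}) ` \<A>) \<le> 2 * (\<Sum>i\<le>Suc d. n choose i)"
      unfolding n_def
    proof (rule insert.IH)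
      show "(\<lambda>A. A - {x}) ` \<A> \<subseteq> Pow R" using insert.prems(1) by auto
      show "\<forall>Q \<in> QQ. \<not> config R ((\<lambda>A. A - {x}) ` \<A>) Q"
        using insert.prems(2) config_delete_row[of "insert x R" x \<A>] unfolding R by blast
    qed
    \<comment> \<open>The standard part avoids \<open>QQ'\<close>, so the bound with
      \<open>d\<close> in place of \<open>Suc d\<close> applies to it.\<close>
    moreover have "card (standard_part x \<A>) \<le> 2 * (\<Sum>i\<le>d. n choose i)"
    proof -
      have "standard_part x \<A> \<subseteq> Pow R" using insert.prems(1) by (auto simp: standard_part_def)
      moreover have "\<forall>Q' \<in> QQ'. \<not> config R (standard_part x \<A>) Q'"
        using insert.prems(2) child config_insert_row[of "insert x R" x \<A>] unfolding R by blast
      ultimately show ?thesis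
        using bd insert.hyps unfolding bounded_avoiders_def n_def by blast
    qed
    moreover have "card (insert x R) - 1 = Suc n" using insert.hyps n by simp
    ultimately show ?case using sum_choose_Suc[of n d] by (simp del: sum.atMost_Suc)
  qed
qed

lemma bounded_avoiders_rev:
  assumes "bounded_avoiders TYPE('a) QQ d"
  shows "bounded_avoiders TYPE('a) ((`) rev ` QQ) d"
  unfolding bounded_avoiders_def
proof (intro allI impI)
  fix R :: "'a set" and \<A>
  assume R: "finite R" "R \<noteq> {}" "\<A> \<subseteq> Pow R" and av: "\<forall>Q \<in> (`) rev ` QQ. \<not> config R \<A> Q"
  have "\<forall>Q \<in> QQ. \<not> config R \<A> Q" using av by (auto dest: config_rev)
  then show "card \<A> \<le> 2 * (\<Sum>i\<le>d. (card R - 1) choose i)"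
    using assms R unfolding bounded_avoiders_def by simp
qed

section \<open>The base case of three columns\<close>

abbreviation (input) "\<I> \<equiv> True"
abbreviation (input) "\<O> \<equiv> False"

text \<open>The listed sets are the four choices of three columns on two rows, up to swapping the
  rows. Among three distinct sets some element separates one from the other two, and a second
  element separates those two; on these two rows the three traces are distinct.\<close>

lemma bounded_avoiders_three_columns:
  "bounded_avoiders TYPE('a) {{[\<O>,\<O>],[\<O>,\<I>],[\<I>,\<O>]}, {[\<O>,\<O>],[\<O>,\<I>],[\<I>,\<I>]}, {[\<O>,\<I>],[\<I>,\<O>],[\<I>,\<I>]}} 0"
  unfolding bounded_avoiders_def
proof (intro allI impI, rule ccontr)
  fix R :: "'a set" and \<A>
  assume sub: "\<A> \<subseteq> Pow R"
    and av: "\<forall>Q \<in> {{[\<O>,\<O>],[\<O>,\<I>],[\<I>,\<O>]}, {[\<O>,\<O>],[\<O>,\<I>],[\<I>,\<I>]}, {[\<O>,\<I>],[\<I>,\<O>],[\<I>,\<I>]}}. \<not> config R \<A> Q"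
    and "\<not> card \<A> \<le> 2 * (\<Sum>i\<le>0. (card R - 1) choose i)"
  then have "3 \<le> card \<A>" by simp
  then obtain A B C where ABC: "A \<in> \<A>" "B \<in> \<A>" "C \<in> \<A>" "A \<noteq> B" "A \<noteq> C" "B \<noteq> C"
    unfolding numeral_3_eq_3 card_le_Suc_iff by auto
  \<comment> \<open>Here \<open>x\<close> separates \<open>P\<close> from both \<open>S\<close> and
    \<open>W\<close>, and \<open>y\<close> separates \<open>S\<close> from \<open>W\<close>.\<close>
  have key: False
    if P: "P \<in> \<A>" "S \<in> \<A>" "W \<in> \<A>" and xy: "x \<in> P \<longleftrightarrow> x \<notin> S" "x \<in> S \<longleftrightarrow> x \<in> W" "y \<in> S \<longleftrightarrow> y \<notin> W"
    for P S W x y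
  proof -
    have "P \<subseteq> R" "S \<subseteq> R" "W \<subseteq> R" using P sub by auto
    then have R: "x \<in> R" "y \<in> R" "x \<noteq> y" using xy by blast+
    \<comment> \<open>Both row orders are recorded, since only one of the two sets that differ by a
      row swap is listed.\<close>
    have "config R \<A> {trace [x,y] P, trace [x,y] S, trace [x,y] W}"
      unfolding config_def using R P by (intro exI[of _ "[x,y]"]) simp
    moreover have "config R \<A> {trace [y,x] P, trace [y,x] S, trace [y,x] W}"
      unfolding config_def using R P by (intro exI[of _ "[y,x]"]) simp
    moreover have "{trace [x,y] P, trace [x,y] S, trace [x,y] W} \<in>
         {{[\<O>,\<O>],[\<O>,\<I>],[\<I>,\<O>]}, {[\<O>,\<O>],[\<O>,\<I>],[\<I>,\<I>]}, {[\<O>,\<I>],[\<I>,\<O>],[\<I>,\<I>]}} \<or>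
       {trace [y,x] P, trace [y,x] S, trace [y,x] W} \<in>
         {{[\<O>,\<O>],[\<O>,\<I>],[\<I>,\<O>]}, {[\<O>,\<O>],[\<O>,\<I>],[\<I>,\<I>]}, {[\<O>,\<I>],[\<I>,\<O>],[\<I>,\<I>]}}"
      using xy unfolding trace_def
      by (cases "x \<in> S"; cases "y \<in> S"; cases "y \<in> P") (simp_all add: insert_commute)
    ultimately show False using av by metis
  qed
  obtain x where x: "x \<in> A \<longleftrightarrow> x \<notin> B" using ABC(4) by auto
  obtain y where y: "y \<in> A \<longleftrightarrow> y \<notin> C" using ABC(5) by auto
  obtain z where z: "z \<in> B \<longleftrightarrow> z \<notin> C" using ABC(6) by auto
  show False
  \<comment> \<open>The set \<open>C\<close> lies on the side of \<open>A\<close> or of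
    \<open>B\<close> with respect to \<open>x\<close>; the remaining set plays the role of
    \<open>P\<close>.\<close>
  proof (cases "x \<in> C \<longleftrightarrow> x \<in> A")
    case True
    then have "x \<in> B \<longleftrightarrow> x \<notin> A" "x \<in> A \<longleftrightarrow> x \<in> C" using x by blast+
    then show False using key ABC(1-3) y by metis
  next
    case False
    then have "x \<in> B \<longleftrightarrow> x \<in> C" using x by blast
    then show False using key ABC(1-3) x z by metis
  qed
qed

section \<open>Upper bounds for the product configurations\<close>

definition cprod :: "bool list set \<Rightarrow> nat \<Rightarrow> bool list set" where
  "cprod Q t = {q @ b | q b. q \<in> Q \<and> length b = t}"

definition G1_cols :: "bool list set" where
  "G1_cols = {[\<I>,\<I>,\<O>],[\<I>,\<O>,\<I>],[\<I>,\<O>,\<O>],[\<O>,\<I>,\<O>]}"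

definition G3_cols :: "bool list set" where
  "G3_cols = {[\<O>,\<O>,\<O>,\<I>],[\<O>,\<O>,\<I>,\<O>],[\<O>,\<O>,\<I>,\<I>],[\<O>,\<I>,\<O>,\<I>],[\<I>,\<O>,\<O>,\<I>],[\<O>,\<I>,\<I>,\<O>],[\<O>,\<I>,\<I>,\<I>],[\<I>,\<O>,\<I>,\<I>]}"

text \<open>Deleting the first row of the factor \<open>K (Suc t)\<close>, which stands at position
  \<open>n\<close>, leaves the product with \<open>K t\<close>.\<close>

lemma bounded_avoiders_cprod_Suc:
  assumes bd: "bounded_avoiders TYPE('a) {cprod Q t} d" and len: "\<forall>q \<in> Q. length q = n"
  shows "bounded_avoiders TYPE('a) {cprod Q (Suc t)} (Suc d)"
proof (rule bounded_avoiders_Suc[OF bd])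
  have "n < length q \<and> take n q @ drop (Suc n) q \<in> cprod Q t" if q: "q \<in> cprod Q (Suc t)" for q
  proof -
    obtain u v where "q = u @ v" "u \<in> Q" "length v = Suc t"
      using q by (auto simp: cprod_def)
    moreover from this(3) obtain b c where "v = b # c" "length c = t"
      by (auto simp: length_Suc_conv)
    ultimately have "q = u @ b # c" "u \<in> Q" "length c = t" by auto
    then show ?thesis using len by (auto simp: cprod_def)
  qed
  then show "\<forall>Q' \<in> {cprod Q t}. \<exists>P \<in> {cprod Q (Suc t)}. \<exists>i. \<forall>q \<in> P.
      i < length q \<and> take i q @ drop (Suc i) q \<in> Q'"
    by blast
qed

text \<open>Deleting rows 0, 1, 2 of \<open>G1\<close> gives the three sets in this order. The
  middle one appears with its rows swapped, hence the passage to reversed lists.\<close>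

lemma bounded_avoiders_G1: "bounded_avoiders TYPE('a) {G1_cols} 1"
proof -
  have "(`) rev ` {{[\<O>,\<O>],[\<O>,\<I>],[\<I>,\<O>]}, {[\<O>,\<O>],[\<O>,\<I>],[\<I>,\<I>]}, {[\<O>,\<I>],[\<I>,\<O>],[\<I>,\<I>]}} =
     {{[\<O>,\<O>],[\<I>,\<O>],[\<O>,\<I>]}, {[\<O>,\<O>],[\<I>,\<O>],[\<I>,\<I>]}, {[\<I>,\<O>],[\<O>,\<I>],[\<I>,\<I>]}}"
    by simp
  then have b: "bounded_avoiders TYPE('a) {{[\<O>,\<O>],[\<I>,\<O>],[\<O>,\<I>]}, {[\<O>,\<O>],[\<I>,\<O>],[\<I>,\<I>]}, {[\<I>,\<O>],[\<O>,\<I>],[\<I>,\<I>]}} 0"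
    using bounded_avoiders_rev[OF bounded_avoiders_three_columns] by metis
  show ?thesis
    unfolding One_nat_def G1_cols_def
    by (rule bounded_avoiders_Suc[OF b], simp only: ball_simps bex_simps simp_thms, intro conjI)
      (rule exI[of _ 0], simp, rule exI[of _ 1], simp, rule exI[of _ 2], simp)
qed

text \<open>The two sets of five columns come from deleting row 1 and row 2 of \<open>G3\<close>.
  Deleting row 2 of the second, row 1 of the first and row 0 of the first gives the three sets of
  the base case.\<close>

lemma bounded_avoiders_G3: "bounded_avoiders TYPE('a) {G3_cols} 2"
proof -
  have "bounded_avoiders TYPE('a) {{[\<O>,\<O>,\<I>],[\<O>,\<I>,\<O>],[\<O>,\<I>,\<I>],[\<I>,\<O>,\<I>],[\<I>,\<I>,\<I>]},
     {[\<O>,\<O>,\<O>],[\<O>,\<O>,\<I>],[\<O>,\<I>,\<O>],[\<O>,\<I>,\<I>],[\<I>,\<O>,\<I>]}} (Suc 0)"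
    by (rule bounded_avoiders_Suc[OF bounded_avoiders_three_columns],
        simp only: ball_simps bex_simps simp_thms, intro conjI)
      (rule disjI2, rule exI[of _ 2], simp, rule disjI1, rule exI[of _ 1], simp,
        rule disjI1, rule exI[of _ 0], simp)
  then show ?thesis
    unfolding numeral_2_eq_2 G3_cols_def
    by (rule bounded_avoiders_Suc, simp only: ball_simps bex_simps simp_thms, intro conjI)
      (rule exI[of _ 1], simp, rule exI[of _ 2], simp)
qed

section \<open>Columns with few alternations\<close>

text \<open>\<open>b\<close> is the entry in row \<open>0\<close>, and the entry changes between rows \<open>j\<close> and \<open>j + 1\<close> for
  \<open>j \<in> D\<close>.\<close>

definition alternations :: "nat \<Rightarrow> bool \<Rightarrow> nat set \<Rightarrow> nat set" where
  "alternations m b D = {j. j < m \<and> (b \<noteq> odd (card (D \<inter> {..<j})))}"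

definition few_alternations :: "nat \<Rightarrow> nat \<Rightarrow> nat set set" where
  "few_alternations m d =
     (\<lambda>(b, D). alternations m b D) ` (UNIV \<times> {D. D \<subseteq> {..<m - 1} \<and> card D \<le> d})"

lemma card_Int_lessThan_Suc:
  "card (D \<inter> {..<Suc j}) = card (D \<inter> {..<j}) + (if j \<in> D then 1 else 0)"
  by (auto simp: lessThan_Suc Int_insert_right)

text \<open>Row 0, present since \<open>1 \<le> m\<close>, reveals \<open>b\<close>; afterwards the
  parity of the count flips from row \<open>j\<close> to row \<open>j + 1\<close> exactly when
  \<open>j \<in> D\<close>.\<close>

lemma alternations_eqD:
  assumes "1 \<le> m" "D \<subseteq> {..<m - 1}" "D' \<subseteq> {..<m - 1}"
    and eq: "alternations m b D = alternations m b' D'"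
  shows "b = b' \<and> D = D'"
proof -
  have e: "(b \<noteq> odd (card (D \<inter> {..<j}))) = (b' \<noteq> odd (card (D' \<inter> {..<j})))" if "j < m" for j
    using eq that by (auto simp: alternations_def set_eq_iff)
  have b: "b = b'" using e[of 0] assms(1) by simp
  have "j \<in> D \<longleftrightarrow> j \<in> D'" if "j < m - 1" for j
  proof -
    have "odd (card (D \<inter> {..<j})) = odd (card (D' \<inter> {..<j}))"
      "odd (card (D \<inter> {..<Suc j})) = odd (card (D' \<inter> {..<Suc j}))"
      using e[of j] e[of "Suc j"] that b by auto
    then show ?thesis
      unfolding card_Int_lessThan_Suc by (cases "j \<in> D"; cases "j \<in> D'") simp_all
  qed
  then show ?thesis using b assms(2,3) by blast
qed

text \<open>There are two choices for the top entry and at most \<open>d\<close> change positions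
  among \<open>m - 1\<close> gaps; distinct choices give distinct columns.\<close>

lemma card_few_alternations:
  assumes "1 \<le> m"
  shows "card (few_alternations m d) = 2 * (\<Sum>i\<le>d. (m - 1) choose i)"
proof -
  have "{D. D \<subseteq> {..<m - 1} \<and> card D \<le> d} = (\<Union>i\<le>d. {D. D \<subseteq> {..<m - 1} \<and> card D = i})"
    by auto
  also have "card \<dots> = (\<Sum>i\<le>d. card {D. D \<subseteq> {..<m - 1} \<and> card D = i})"
    by (rule card_UN_disjoint) auto
  also have "\<dots> = (\<Sum>i\<le>d. (m - 1) choose i)"
    by (simp add: n_subsets)
  finally have "card {D. D \<subseteq> {..<m - 1} \<and> card D \<le> d} = (\<Sum>i\<le>d. (m - 1) choose i)" .
  moreover have "inj_on (\<lambda>(b, D). alternations m b D) (UNIV \<times> {D. D \<subseteq> {..<m - 1} \<and> card D \<le> d})"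
  proof (rule inj_onI, clarify)
    fix b b' D D'
    assume "D \<subseteq> {..<m - 1}" "D' \<subseteq> {..<m - 1}" "alternations m b D = alternations m b' D'"
    then show "b = b' \<and> D = D'" using alternations_eqD[OF assms] by blast
  qed
  ultimately show ?thesis
    unfolding few_alternations_def by (simp add: card_image card_cartesian_product)
qed

text \<open>If a column alternates along the rows of \<open>R\<close>, it changes at least once
  between consecutive rows of \<open>R\<close>, so the changes above \<open>r\<close> are at least
  as many as the rows of \<open>R\<close> above \<open>r\<close>. The value \<open>c\<close> selects
  one of the two alternating patterns.\<close>

lemma rank_le_card_Int:
  fixes R D :: "nat set"
  assumes fin: "finite R" and r: "r \<in> R"
    and par: "\<And>r. r \<in> R \<Longrightarrow> (even (card {x \<in> R. x < r}) = c) \<longleftrightarrow> (b \<noteq> odd (card (D \<inter> {..<r})))"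
  shows "card {x \<in> R. x < r} \<le> card (D \<inter> {..<r})"
  using r
proof (induction r rule: less_induct)
  case (less r)
  let ?S = "{x \<in> R. x < r}"
  show ?case
  proof (cases "?S = {}")
    case False
    \<comment> \<open>The predecessor of \<open>r\<close> in \<open>R\<close>.\<close>
    define s where "s = Max ?S"
    have s: "s \<in> R" "s < r" using Max_in[of ?S] False fin unfolding s_def by auto
    have "?S = insert s {x \<in> R. x < s}"
      using s fin Max_ge[of ?S] unfolding s_def[symmetric] by (fastforce simp: order.order_iff_strict)
    then have rank: "card ?S = Suc (card {x \<in> R. x < s})" using fin by simp
    have "card (D \<inter> {..<s}) \<le> card (D \<inter> {..<r})" using s(2) by (intro card_mono) auto
    \<comment> \<open>The ranks of \<open>s\<close> and \<open>r\<close> have opposite parity, hence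
      so do the two counts of changes.\<close>
    moreover have "card (D \<inter> {..<s}) \<noteq> card (D \<inter> {..<r})"
      using par[OF s(1)] par[OF less.prems] rank by auto
    ultimately show ?thesis using less.IH[OF s(2,1)] rank by simp
  next
    case True
    show ?thesis unfolding True by simp
  qed
qed

text \<open>Through \<open>pick\<close> the elements of \<open>R\<close> correspond to their ranks
  below \<open>card R\<close>, of which half, rounded up, are even.\<close>

lemma card_even_rank:
  fixes R :: "nat set"
  assumes "finite R"
  shows "card {r \<in> R. even (card {x \<in> R. x < r})} = (card R + 1) div 2"
proof -
  have "bij_betw (pick R) {i. i < card R \<and> even i} {r \<in> R. even (card {x \<in> R. x < r})}"
  proof (rule bij_betwI[where g = "\<lambda>r. card {x \<in> R. x < r}"])
    show "pick R \<in> {i. i < card R \<and> even i} \<rightarrow> {r \<in> R. even (card {x \<in> R. x < r})}"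
      by (auto simp: card_pick pick_in_set)
    have "card {x \<in> R. x < r} < card R" if "r \<in> R" for r
      using assms that by (intro psubset_card_mono) auto
    then show "(\<lambda>r. card {x \<in> R. x < r}) \<in> {r \<in> R. even (card {x \<in> R. x < r})} \<rightarrow> {i. i < card R \<and> even i}"
      by auto
  qed (auto simp: card_pick pick_card_in_set)
  then have "card {r \<in> R. even (card {x \<in> R. x < r})} = card {i. i < card R \<and> even i}"
    by (simp add: bij_betw_same_card)
  also have "{i. i < card R \<and> even i} = (*) 2 ` {..<(card R + 1) div 2}"
    by (auto elim!: evenE)
  also have "card \<dots> = (card R + 1) div 2"
    by (subst card_image) (auto simp: inj_on_def)
  finally show ?thesis .
qed

text \<open>On any \<open>d + 2\<close> rows an alternating column needs \<open>d + 1\<close>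
  changes. One of the two alternating columns has \<open>(d + 3) div 2\<close> ones, in whatever
  order the rows are listed, so \<open>bal\<close> puts it or its complement into
  \<open>Q\<close>.\<close>

lemma few_alternations_avoid:
  assumes len: "\<forall>q \<in> Q. length q = Suc (Suc d)" and ne: "Q \<noteq> {}"
    and bal: "\<And>q. length q = Suc (Suc d) \<Longrightarrow> length (filter id q) = (d + 3) div 2 \<Longrightarrow> q \<in> Q \<or> map Not q \<in> Q"
  shows "\<not> config {..<m} (few_alternations m d) Q"
proof
  assume "config {..<m} (few_alternations m d) Q"
  then obtain rs where rs: "distinct rs" "set rs \<subseteq> {..<m}" "Q \<subseteq> trace rs ` few_alternations m d"
    by (auto simp: config_def)
  define R where "R = set rs"
  \<comment> \<open>Alternating along the rows in increasing order, but written in the order of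
    \<open>rs\<close>.\<close>
  define q where "q = map (\<lambda>r. even (card {x \<in> R. x < r})) rs"
  have lrs: "length rs = Suc (Suc d)" using ne len rs(3) by (fastforce simp: trace_def)
  have cR: "card R = Suc (Suc d)" using rs(1) lrs distinct_card R_def by metis
  have "length (filter id q) = card (set (filter (\<lambda>r. even (card {x \<in> R. x < r})) rs))"
    using distinct_card[OF distinct_filter[OF rs(1)], of "\<lambda>r. even (card {x \<in> R. x < r})"]
    by (simp add: q_def filter_map comp_def)
  also have "\<dots> = (d + 3) div 2"
    using card_even_rank[of R] cR by (simp add: R_def)
  finally have "q \<in> Q \<or> map Not q \<in> Q" using bal[of q] lrs by (simp add: q_def)
  \<comment> \<open>\<open>True\<close> stands for \<open>q\<close> itself, \<open>False\<close> for
    its complement.\<close>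
  then obtain c where "map (\<lambda>r. even (card {x \<in> R. x < r}) = c) rs \<in> Q"
  proof
    assume "q \<in> Q"
    then show ?thesis using that[of True] by (simp add: q_def)
  next
    assume "map Not q \<in> Q"
    then show ?thesis using that[of False] by (simp add: q_def comp_def)
  qed
  then obtain A where A: "A \<in> few_alternations m d"
    "map (\<lambda>r. even (card {x \<in> R. x < r}) = c) rs = trace rs A" using rs(3) by auto
  then obtain b D where D: "D \<subseteq> {..<m - 1}" "card D \<le> d" "A = alternations m b D"
    by (auto simp: few_alternations_def)
  have fin: "finite R" by (simp add: R_def)
  have par: "(even (card {x \<in> R. x < r}) = c) \<longleftrightarrow> (b \<noteq> odd (card (D \<inter> {..<r})))" if "r \<in> R" for r
    using A(2) that rs(2) unfolding D(3) by (auto simp: trace_def alternations_def R_def)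
  \<comment> \<open>The last of the \<open>d + 2\<close> rows has rank \<open>d + 1\<close>, one
    more than the allowed number of changes.\<close>
  have "pick R (Suc d) \<in> R" "card {x \<in> R. x < pick R (Suc d)} = Suc d"
    using cR by (auto simp: pick_in_set card_pick simp del: pick.simps)
  then have "Suc d \<le> card (D \<inter> {..<pick R (Suc d)})"
    using rank_le_card_Int[OF fin _ par] by metis
  also have "\<dots> \<le> card D" using D(1) by (intro card_mono) (auto intro: finite_subset)
  finally show False using D(2) by simp
qed

section \<open>Balanced columns in the configurations\<close>

lemma G1_cols_balanced:
  assumes "length u = 3" "length (filter id u) \<in> {1, 2}"
  shows "u \<in> G1_cols \<or> map Not u \<in> G1_cols"
proof -
  obtain x y z where "u = [x, y, z]"
    using assms(1) by (auto simp: numeral_eq_Suc length_Suc_conv)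
  then show ?thesis using assms(2) by (cases x; cases y; cases z) (auto simp: G1_cols_def)
qed

lemma G3_cols_balanced:
  assumes "length u = 4" "length (filter id u) \<in> {1, 2, 3}"
  shows "u \<in> G3_cols \<or> map Not u \<in> G3_cols"
proof -
  obtain x y z w where "u = [x, y, z, w]"
    using assms(1) by (auto simp: numeral_eq_Suc length_Suc_conv)
  then show ?thesis using assms(2) by (cases x; cases y; cases z; cases w) (auto simp: G3_cols_def)
qed

text \<open>The lower \<open>t\<close> entries are unrestricted and hold between 0 and
  \<open>t\<close> ones, so only the upper part \<open>u\<close> matters, and it has between
  \<open>l - t\<close> and \<open>l\<close> ones.\<close>

lemma cprod_balanced:
  assumes Q: "\<And>u. length u = n \<Longrightarrow> l \<le> length (filter id u) + t \<Longrightarrow> length (filter id u) \<le> l \<Longrightarrow>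
      u \<in> Q \<or> map Not u \<in> Q"
    and q: "length q = n + t" "length (filter id q) = l"
  shows "q \<in> cprod Q t \<or> map Not q \<in> cprod Q t"
proof -
  define u b where "u = take n q" and "b = drop n q"
  have ub: "q = u @ b" "length u = n" "length b = t" using q(1) by (auto simp: u_def b_def)
  have "length (filter id b) \<le> t" using ub(3) length_filter_le by metis
  then have "u \<in> Q \<or> map Not u \<in> Q" using Q[of u] ub q(2) by simp
  moreover have "map Not q = map Not u @ map Not b" "length (map Not b) = t" using ub by simp_all
  ultimately show ?thesis unfolding cprod_def using ub by blast
qed

section \<open>Translation to matrices\<close>

text \<open>Columns get two encodings: lists for the configuration \<open>F\<close>, whose rows are
  indexed by position, and sets (\<open>col_set\<close>) for the host matrix, whose columns form a
  set family.\<close>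

definition col_list :: "nat mat \<Rightarrow> nat \<Rightarrow> bool list" where
  "col_list M j = map (\<lambda>i. M $$ (i, j) = 1) [0..<dim_row M]"

definition col_lists :: "nat mat \<Rightarrow> bool list set" where
  "col_lists M = col_list M ` {..<dim_col M}"

definition col_set :: "nat mat \<Rightarrow> nat \<Rightarrow> nat set" where
  "col_set M j = {i. i < dim_row M \<and> M $$ (i, j) = 1}"

lemma zero_one_mat_iff:
  "zero_one_mat M \<longleftrightarrow> (\<forall>i < dim_row M. \<forall>j < dim_col M. M $$ (i, j) \<in> {0, 1})"
  unfolding zero_one_mat_def elements_mat_def
  by (simp add: UN_subset_iff image_subset_iff Ball_def)

lemma col_list_eq_iff:
  assumes "zero_one_mat M" "j < dim_col M" "j' < dim_col M"
  shows "col_list M j = col_list M j' \<longleftrightarrow> col M j = col M j'"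
    and "col_set M j = col_set M j' \<longleftrightarrow> col M j = col M j'"
proof -
  have c: "col M j = col M j' \<longleftrightarrow> (\<forall>i < dim_row M. M $$ (i, j) = M $$ (i, j'))"
    using assms(2,3) by (auto simp: vec_eq_iff)
  have e: "(M $$ (i, j) = 1) = (M $$ (i, j') = 1) \<longleftrightarrow> M $$ (i, j) = M $$ (i, j')" if "i < dim_row M" for i
  proof -
    have "M $$ (i, j) \<in> {0, 1}" "M $$ (i, j') \<in> {0, 1}"
      using assms that unfolding zero_one_mat_iff by blast+
    then show ?thesis by auto
  qed
  have a: "(\<forall>i < dim_row M. (M $$ (i, j) = 1) = (M $$ (i, j') = 1)) \<longleftrightarrow> col M j = col M j'"
    unfolding c by (intro all_cong e)
  show "col_list M j = col_list M j' \<longleftrightarrow> col M j = col M j'"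
    unfolding a[symmetric] by (simp add: col_list_def Ball_def)
  show "col_set M j = col_set M j' \<longleftrightarrow> col M j = col M j'"
    unfolding a[symmetric] col_set_def set_eq_iff by blast
qed

lemma distinct_cols_iff: "distinct (cols M) \<longleftrightarrow> inj_on (col M) {..<dim_col M}"
  by (simp add: cols_def distinct_map atLeast0LessThan)

lemma simple_mat_iff_inj_on_col_list:
  "simple_mat M \<longleftrightarrow> zero_one_mat M \<and> inj_on (col_list M) {..<dim_col M}"
  unfolding simple_mat_def distinct_cols_iff inj_on_def using col_list_eq_iff(1) by (metis lessThan_iff)

lemma simple_mat_iff_inj_on_col_set:
  "simple_mat M \<longleftrightarrow> zero_one_mat M \<and> inj_on (col_set M) {..<dim_col M}"
  unfolding simple_mat_def distinct_cols_iff inj_on_def using col_list_eq_iff(2) by (metis lessThan_iff)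

lemma col_list_mat_product:
  assumes "j < dim_col A * dim_col B"
  shows "col_list (A \<otimes>\<^sub>c B) j = col_list A (j div dim_col B) @ col_list B (j mod dim_col B)"
  using assms by (intro nth_equalityI) (auto simp: col_list_def mat_product_def nth_append)

lemma div_mod_less_product:
  fixes j a b :: nat
  assumes "j < a * b"
  shows "j div b < a" "j mod b < b"
  using assms by (auto simp: less_mult_imp_div_less) (metis mod_less_divisor mult_0_right neq0_conv not_less_zero)

lemma simple_mat_product:
  assumes "simple_mat A" "simple_mat B"
  shows "simple_mat (A \<otimes>\<^sub>c B)"
proof -
  have "zero_one_mat (A \<otimes>\<^sub>c B)"
    using assms unfolding simple_mat_def zero_one_mat_iff
    by (auto simp: mat_product_def div_mod_less_product)
  moreover have "inj_on (col_list (A \<otimes>\<^sub>c B)) {..<dim_col (A \<otimes>\<^sub>c B)}"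
  proof (rule inj_onI)
    fix j j' assume "j \<in> {..<dim_col (A \<otimes>\<^sub>c B)}" "j' \<in> {..<dim_col (A \<otimes>\<^sub>c B)}"
      and e: "col_list (A \<otimes>\<^sub>c B) j = col_list (A \<otimes>\<^sub>c B) j'"
    then have j: "j < dim_col A * dim_col B" "j' < dim_col A * dim_col B"
      by (auto simp: mat_product_def)
    have "length (col_list A (j div dim_col B)) = length (col_list A (j' div dim_col B))"
      by (simp add: col_list_def)
    then have "col_list A (j div dim_col B) = col_list A (j' div dim_col B)"
      "col_list B (j mod dim_col B) = col_list B (j' mod dim_col B)"
      using e unfolding col_list_mat_product[OF j(1)] col_list_mat_product[OF j(2)] by auto
    then have "j div dim_col B = j' div dim_col B" "j mod dim_col B = j' mod dim_col B"
      using assms div_mod_less_product[OF j(1)] div_mod_less_product[OF j(2)]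
      unfolding simple_mat_iff_inj_on_col_list inj_on_def by auto
    then show "j = j'" by (metis div_mult_mod_eq)
  qed
  ultimately show ?thesis by (simp add: simple_mat_iff_inj_on_col_list)
qed

lemma simple_mat_K: "simple_mat (K t)"
  unfolding simple_mat_def zero_one_mat_iff using distinct_cols_K by (auto simp: K_def)

text \<open>By counting: the \<open>2 ^ t\<close> columns are distinct, and there are just as many
  lists of length \<open>t\<close>.\<close>

lemma col_lists_K: "col_lists (K t) = {b. length b = t}"
proof (rule card_subset_eq)
  have L: "{b :: bool list. length b = t} = {b. set b \<subseteq> UNIV \<and> length b = t}" by simp
  show "finite {b :: bool list. length b = t}"
    unfolding L by (rule finite_lists_length_eq) simp
  show "col_lists (K t) \<subseteq> {b. length b = t}"
    by (auto simp: col_lists_def col_list_def K_def)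
  have "card (col_lists (K t)) = 2 ^ t"
    unfolding col_lists_def using simple_mat_K[of t]
    by (subst card_image) (auto simp: simple_mat_iff_inj_on_col_list, simp add: K_def)
  also have "\<dots> = card {b :: bool list. length b = t}"
    unfolding L by (subst card_lists_length_eq) auto
  finally show "card (col_lists (K t)) = card {b :: bool list. length b = t}" .
qed

lemma col_lists_mat_product:
  "col_lists (A \<otimes>\<^sub>c B) = {a @ b | a b. a \<in> col_lists A \<and> b \<in> col_lists B}"
proof (intro equalityI subsetI)
  fix q assume "q \<in> col_lists (A \<otimes>\<^sub>c B)"
  then obtain j where j: "j < dim_col A * dim_col B" "q = col_list (A \<otimes>\<^sub>c B) j"
    by (auto simp: col_lists_def mat_product_def)
  then show "q \<in> {a @ b | a b. a \<in> col_lists A \<and> b \<in> col_lists B}"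
    using div_mod_less_product[OF j(1)] col_list_mat_product[OF j(1)] unfolding col_lists_def by blast
next
  fix q assume "q \<in> {a @ b | a b. a \<in> col_lists A \<and> b \<in> col_lists B}"
  then obtain i j where ij: "i < dim_col A" "j < dim_col B" "q = col_list A i @ col_list B j"
    by (auto simp: col_lists_def)
  have "i * dim_col B + j < Suc i * dim_col B" using ij(2) by simp
  also have "\<dots> \<le> dim_col A * dim_col B" using ij(1) by (intro mult_le_mono1) simp
  finally have l: "i * dim_col B + j < dim_col A * dim_col B" .
  have "q = col_list (A \<otimes>\<^sub>c B) (i * dim_col B + j)"
    unfolding col_list_mat_product[OF l] using ij by simp
  then show "q \<in> col_lists (A \<otimes>\<^sub>c B)" using l by (auto simp: col_lists_def mat_product_def)
qed

text \<open>\<open>submatrix\<close> always lists the chosen indices in increasing order; any other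
  enumeration of them differs from this one by a permutation.\<close>

lemma pick_eq_permutation:
  assumes bij: "bij_betw f {..<n} I"
  shows "\<exists>p. p permutes {..<n} \<and> (\<forall>i < n. pick I i = f (p i))"
proof -
  have I: "finite I" "card I = n" using bij bij_betw_finite bij_betw_same_card by fastforce+
  have "inj_on (pick I) {..<n}"
    using I(2) by (intro inj_on_inverseI[where g = "\<lambda>x. card {a \<in> I. a < x}"]) (auto simp: card_pick)
  moreover have sub: "pick I ` {..<n} \<subseteq> I" using I(2) by (auto simp: pick_in_set)
  ultimately have "bij_betw (pick I) {..<n} I"
    unfolding bij_betw_def using I by (metis card_image card_lessThan card_subset_eq)
  then have b: "bij_betw (inv_into {..<n} f \<circ> pick I) {..<n} {..<n}"
    using bij_betw_inv_into[OF bij] by (rule bij_betw_trans)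
  define p where "p i = (if i < n then inv_into {..<n} f (pick I i) else i)" for i
  have "bij_betw p {..<n} {..<n}"
    using b by (rule bij_betw_cong[THEN iffD1, rotated]) (auto simp: p_def)
  then have "p permutes {..<n}" by (rule bij_imp_permutes) (auto simp: p_def)
  moreover have "pick I i = f (p i)" if "i < n" for i
    using that sub bij unfolding p_def bij_betw_def by (auto simp: f_inv_into_f)
  ultimately show ?thesis by blast
qed

lemma configuration_in_imp_config:
  assumes "F \<prec> A"
  shows "config {..<dim_row A} (col_set A ` {..<dim_col A}) (col_lists F)"
proof -
  obtain I J p q where p: "p permutes {..<dim_row F}" and q: "q permutes {..<dim_col F}"
    and e: "submatrix A I J = mat (dim_row F) (dim_col F) (\<lambda>(i, j). F $$ (p i, q j))"
    using assms unfolding configuration_in_def row_col_perm_def by blast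
  have dr: "dim_row F = card {i. i < dim_row A \<and> i \<in> I}"
    using arg_cong[OF e, of dim_row] by (simp add: dim_submatrix)
  have dc: "dim_col F = card {j. j < dim_col A \<and> j \<in> J}"
    using arg_cong[OF e, of dim_col] by (simp add: dim_submatrix)
  \<comment> \<open>Row \<open>i\<close> of \<open>F\<close> sits in row
    \<open>inv_into UNIV p i\<close> of the submatrix; \<open>pick I\<close> turns that into a row
    of \<open>A\<close>.\<close>
  define rs where "rs = map (\<lambda>i. pick I (inv_into UNIV p i)) [0..<dim_row F]"
  have ip: "inv_into UNIV p i < dim_row F" if "i < dim_row F" for i
    using permutes_in_image[OF permutes_inv[OF p], of i] that by simp
  have iq: "inv_into UNIV q j < dim_col F" if "j < dim_col F" for j
    using permutes_in_image[OF permutes_inv[OF q], of j] that by simp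
  have "inj_on (pick I) {..<dim_row F}"
  proof (rule inj_on_inverseI[where g = "\<lambda>x. card {a \<in> I. a < x}"])
    fix i assume "i \<in> {..<dim_row F}"
    \<comment> \<open>The index set \<open>I\<close> is arbitrary: it may be infinite or reach
      beyond the rows of \<open>A\<close>.\<close>
    moreover have "dim_row F \<le> card I" if "finite I"
      unfolding dr using that by (intro card_mono) auto
    ultimately show "card {a \<in> I. a < pick I i} = i" by (intro card_pick) fastforce
  qed
  moreover have "inj (inv_into UNIV p)" using permutes_inv[OF p] permutes_inj by blast
  ultimately have "inj_on (\<lambda>i. pick I (inv_into UNIV p i)) {..<dim_row F}"
    using ip by (intro inj_onI) (meson inj_onD injD lessThan_iff)
  then have "distinct rs" by (simp add: rs_def distinct_map atLeast0LessThan)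
  moreover have "set rs \<subseteq> {..<dim_row A}"
    using ip dr pick_le[of _ "dim_row A" I] by (auto simp: rs_def)
  moreover have "col_list F j \<in> trace rs ` col_set A ` {..<dim_col A}" if j: "j < dim_col F" for j
  proof -
    have "A $$ (pick I (inv_into UNIV p i), pick J (inv_into UNIV q j)) = F $$ (i, j)" if i: "i < dim_row F" for i
    proof -
      have "A $$ (pick I (inv_into UNIV p i), pick J (inv_into UNIV q j)) = submatrix A I J $$ (inv_into UNIV p i, inv_into UNIV q j)"
        using ip[OF i] iq[OF j] dr dc by (simp add: submatrix_index)
      also have "\<dots> = F $$ (i, j)"
        unfolding e using ip[OF i] iq[OF j] permutes_inverses(1)[OF p] permutes_inverses(1)[OF q] by simp
      finally show ?thesis .
    qed
    moreover have "pick I (inv_into UNIV p i) < dim_row A" if "i < dim_row F" for i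
      using ip[OF that] dr pick_le by metis
    ultimately have "col_list F j = trace rs (col_set A (pick J (inv_into UNIV q j)))"
      by (auto simp: col_list_def trace_def rs_def col_set_def)
    moreover have "pick J (inv_into UNIV q j) < dim_col A" using iq[OF j] dc pick_le by metis
    ultimately show ?thesis by blast
  qed
  ultimately show ?thesis unfolding config_def col_lists_def by blast
qed

text \<open>Distinct columns of the simple matrix \<open>F\<close> are traces of distinct columns of
  \<open>A\<close>, so the chosen columns of \<open>A\<close> are as many as those of
  \<open>F\<close>, and two permutations account for their order and that of the rows.\<close>

lemma config_imp_configuration_in:
  assumes A: "simple_mat A" and F: "simple_mat F" and ne: "dim_col F > 0"
    and c: "config {..<dim_row A} (col_set A ` {..<dim_col A}) (col_lists F)"
  shows "F \<prec> A"
proof -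
  obtain rs where rs: "distinct rs" "set rs \<subseteq> {..<dim_row A}"
    "col_lists F \<subseteq> trace rs ` col_set A ` {..<dim_col A}"
    using c by (auto simp: config_def)
  have "\<forall>j \<in> {..<dim_col F}. \<exists>l. l < dim_col A \<and> col_list F j = trace rs (col_set A l)"
    using rs(3) unfolding col_lists_def by blast
  from bchoice[OF this] obtain g where g: "\<And>j. j < dim_col F \<Longrightarrow> g j < dim_col A"
    "\<And>j. j < dim_col F \<Longrightarrow> col_list F j = trace rs (col_set A (g j))" by auto
  \<comment> \<open>The number of rows is read off from column 0, which exists by
    \<open>ne\<close>.\<close>
  have len: "length rs = dim_row F"
    using arg_cong[OF g(2)[OF ne], of length] by (simp add: trace_def col_list_def)
  have ent: "A $$ (rs ! i, g j) = F $$ (i, j)" if i: "i < dim_row F" and j: "j < dim_col F" for i j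
  proof -
    have r: "rs ! i < dim_row A" using subsetD[OF rs(2) nth_mem[of i rs]] i len by simp
    have "col_list F j ! i = trace rs (col_set A (g j)) ! i" using g(2)[OF j] by simp
    then have "(F $$ (i, j) = 1) = (A $$ (rs ! i, g j) = 1)"
      using i len r by (simp add: col_list_def trace_def col_set_def)
    moreover have "F $$ (i, j) \<in> {0, 1}" "A $$ (rs ! i, g j) \<in> {0, 1}"
      using A F r g(1)[OF j] i j unfolding simple_mat_def zero_one_mat_iff by blast+
    ultimately show ?thesis by auto
  qed
  have "inj_on g {..<dim_col F}"
    using F g(2) unfolding simple_mat_iff_inj_on_col_list inj_on_def by (metis lessThan_iff)
  then have bg: "bij_betw g {..<dim_col F} (g ` {..<dim_col F})" by (rule inj_on_imp_bij_betw)
  have bf: "bij_betw ((!) rs) {..<dim_row F} (set rs)"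
    using bij_betw_nth[OF rs(1)] len by simp
  obtain p where p: "p permutes {..<dim_row F}" "\<And>i. i < dim_row F \<Longrightarrow> pick (set rs) i = rs ! p i"
    using pick_eq_permutation[OF bf] by auto
  obtain q where q: "q permutes {..<dim_col F}" "\<And>j. j < dim_col F \<Longrightarrow> pick (g ` {..<dim_col F}) j = g (q j)"
    using pick_eq_permutation[OF bg] by auto
  have "{i. i < dim_row A \<and> i \<in> set rs} = set rs" using rs(2) by auto
  then have dr: "card {i. i < dim_row A \<and> i \<in> set rs} = dim_row F"
    using rs(1) len by (simp add: distinct_card)
  have "{j. j < dim_col A \<and> j \<in> g ` {..<dim_col F}} = g ` {..<dim_col F}" using g(1) by auto
  then have dc: "card {j. j < dim_col A \<and> j \<in> g ` {..<dim_col F}} = dim_col F"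
    using bij_betw_same_card[OF bg] by simp
  have "submatrix A (set rs) (g ` {..<dim_col F}) = mat (dim_row F) (dim_col F) (\<lambda>(i, j). F $$ (p i, q j))"
  proof (rule eq_matI)
    fix i j assume "i < dim_row (mat (dim_row F) (dim_col F) (\<lambda>(i, j). F $$ (p i, q j)))"
      "j < dim_col (mat (dim_row F) (dim_col F) (\<lambda>(i, j). F $$ (p i, q j)))"
    then have ij: "i < dim_row F" "j < dim_col F" by auto
    then have "p i < dim_row F" "q j < dim_col F"
      using permutes_in_image[OF p(1)] permutes_in_image[OF q(1)] by auto
    then show "submatrix A (set rs) (g ` {..<dim_col F}) $$ (i, j) =
        mat (dim_row F) (dim_col F) (\<lambda>(i, j). F $$ (p i, q j)) $$ (i, j)"
      using ij dr dc p(2) q(2) ent by (simp add: submatrix_index)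
  qed (simp_all add: dim_submatrix dr dc)
  then show ?thesis unfolding configuration_in_def row_col_perm_def using p(1) q(1) by blast
qed

lemma ex_simple_mat_col_set:
  assumes "\<A> \<subseteq> Pow {..<m}"
  shows "\<exists>A. dim_row A = m \<and> dim_col A = card \<A> \<and> simple_mat A \<and> col_set A ` {..<dim_col A} = \<A>"
proof -
  have "finite \<A>" using assms by (rule finite_subset) simp
  then obtain h where h: "bij_betw h {..<card \<A>} \<A>"
    using ex_bij_betw_nat_finite atLeast0LessThan by metis
  define A where "A = mat m (card \<A>) (\<lambda>(i, j). if i \<in> h j then 1 else 0 :: nat)"
  have d: "dim_row A = m" "dim_col A = card \<A>" by (simp_all add: A_def)
  have cs: "col_set A j = h j" if "j < card \<A>" for j
  proof -
    have "h j \<subseteq> {..<m}" using that h assms by (auto simp: bij_betw_def)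
    then show ?thesis using that by (auto simp: col_set_def A_def split: if_splits)
  qed
  have "simple_mat A"
    unfolding simple_mat_iff_inj_on_col_set
    using h cs by (auto simp: zero_one_mat_iff A_def bij_betw_def inj_on_def)
  moreover have "col_set A ` {..<dim_col A} = \<A>"
    using h cs d by (auto simp: bij_betw_def image_iff)
  ultimately show ?thesis using d by blast
qed

section \<open>Both bounds combined, and the values for the given matrices\<close>

lemma forb_eqI:
  assumes m: "1 \<le> m" and F: "simple_mat F" "dim_col F > 0" "dim_row F = Suc (Suc d)"
    and up: "bounded_avoiders TYPE(nat) {col_lists F} d"
    and bal: "\<And>q. length q = Suc (Suc d) \<Longrightarrow> length (filter id q) = (d + 3) div 2 \<Longrightarrow>
      q \<in> col_lists F \<or> map Not q \<in> col_lists F"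
  shows "forb m F = 2 * (\<Sum>i\<le>d. (m - 1) choose i)"
  unfolding forb_def
proof (rule Max_eqI)
  show "finite (dim_col ` Avoid m F)" by (rule finite_dim_col_Avoid)
next
  fix n assume "n \<in> dim_col ` Avoid m F"
  then obtain A where A: "n = dim_col A" "dim_row A = m" "simple_mat A" "\<not> F \<prec> A"
    by (auto simp: Avoid_def)
  let ?S = "col_set A ` {..<dim_col A}"
  have "\<not> config {..<m} ?S (col_lists F)"
    using config_imp_configuration_in[OF A(3) F(1,2)] A(2,4) by blast
  moreover have "?S \<subseteq> Pow {..<m}" using A(2) by (auto simp: col_set_def)
  moreover have "{..<m} \<noteq> {}" using m by (simp add: lessThan_empty_iff)
  ultimately have "card ?S \<le> 2 * (\<Sum>i\<le>d. (m - 1) choose i)"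
    using up unfolding bounded_avoiders_def by (metis card_lessThan finite_lessThan singletonD)
  moreover have "card ?S = n"
    using A(1,3) unfolding simple_mat_iff_inj_on_col_set by (simp add: card_image)
  ultimately show "n \<le> 2 * (\<Sum>i\<le>d. (m - 1) choose i)" by simp
next
  have "few_alternations m d \<subseteq> Pow {..<m}" by (auto simp: few_alternations_def alternations_def)
  then obtain A where A: "dim_row A = m" "dim_col A = card (few_alternations m d)" "simple_mat A"
    "col_set A ` {..<dim_col A} = few_alternations m d"
    using ex_simple_mat_col_set by metis
  have "\<not> config {..<m} (few_alternations m d) (col_lists F)"
    by (rule few_alternations_avoid[OF _ _ bal]) (use F in \<open>auto simp: col_lists_def col_list_def\<close>)
  then have "\<not> F \<prec> A" using configuration_in_imp_config[of F A] A(1,4) by metis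
  then have "A \<in> Avoid m F" using A by (simp add: Avoid_def)
  then show "2 * (\<Sum>i\<le>d. (m - 1) choose i) \<in> dim_col ` Avoid m F"
    using A(2) card_few_alternations[OF m] by (metis imageI)
qed

lemma G1_simple: "simple_mat G1" and col_lists_G1: "col_lists G1 = G1_cols"
proof -
  have d: "dim_row G1 = 3" "dim_col G1 = 4" by (simp_all add: G1_def mat_of_rows_list_def)
  have r: "[0..<3] = [0, 1, 2::nat]" by (simp add: upt_rec)
  have c: "col_list G1 0 = [\<I>,\<I>,\<O>]" "col_list G1 (Suc 0) = [\<I>,\<O>,\<I>]" "col_list G1 2 = [\<I>,\<O>,\<O>]" "col_list G1 3 = [\<O>,\<I>,\<O>]"
    unfolding col_list_def d r by (simp_all add: G1_def mat_of_rows_list_def)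
  have i: "{..<4} = {0, 1, 2, 3::nat}" by auto
  have z: "zero_one_mat G1"
    unfolding zero_one_mat_iff d
    by (auto simp: G1_def mat_of_rows_list_def less_Suc_eq numeral_eq_Suc)
  show "simple_mat G1"
    unfolding simple_mat_iff_inj_on_col_list d i using z c by (simp add: inj_on_def)
  show "col_lists G1 = G1_cols" unfolding col_lists_def d i G1_cols_def by (simp add: c)
qed

lemma G3_simple: "simple_mat G3" and col_lists_G3: "col_lists G3 = G3_cols"
proof -
  have d: "dim_row G3 = 4" "dim_col G3 = 8" by (simp_all add: G3_def mat_of_rows_list_def)
  have r: "[0..<4] = [0, 1, 2, 3::nat]" by (simp add: upt_rec)
  have c: "col_list G3 0 = [\<O>,\<O>,\<O>,\<I>]" "col_list G3 (Suc 0) = [\<O>,\<O>,\<I>,\<O>]" "col_list G3 2 = [\<O>,\<O>,\<I>,\<I>]"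
    "col_list G3 3 = [\<O>,\<I>,\<O>,\<I>]" "col_list G3 4 = [\<I>,\<O>,\<O>,\<I>]" "col_list G3 5 = [\<O>,\<I>,\<I>,\<O>]"
    "col_list G3 6 = [\<O>,\<I>,\<I>,\<I>]" "col_list G3 7 = [\<I>,\<O>,\<I>,\<I>]"
    unfolding col_list_def d r by (simp_all add: G3_def mat_of_rows_list_def)
  have i: "{..<8} = {0, 1, 2, 3, 4, 5, 6, 7::nat}" by auto
  have z: "zero_one_mat G3"
    unfolding zero_one_mat_iff d
    by (auto simp: G3_def mat_of_rows_list_def less_Suc_eq numeral_eq_Suc)
  show "simple_mat G3"
    unfolding simple_mat_iff_inj_on_col_list d i using z c by (simp add: inj_on_def)
  show "col_lists G3 = G3_cols" unfolding col_lists_def d i G3_cols_def by (simp add: c)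
qed

lemma col_lists_product_K: "col_lists (A \<otimes>\<^sub>c K t) = cprod (col_lists A) t"
  unfolding col_lists_mat_product col_lists_K cprod_def by simp

lemma cprod_0 [simp]: "cprod Q 0 = Q"
  by (simp add: cprod_def)

text \<open>A column of four entries with two ones has one or two ones in its upper three entries,
  as \<open>G1_cols_balanced\<close> requires.\<close>

lemma forb_F14:
  assumes "1 \<le> m"
  shows "forb m F14 = 2 * (\<Sum>i\<le>2. (m - 1) choose i)"
proof (rule forb_eqI[OF assms])
  have c: "col_lists F14 = cprod G1_cols 1"
    unfolding F14_def col_lists_product_K col_lists_G1 ..
  show "simple_mat F14" unfolding F14_def by (intro simple_mat_product G1_simple simple_mat_K)
  show "0 < dim_col F14" "dim_row F14 = Suc (Suc 2)"
    by (simp_all add: F14_def mat_product_def G1_def K_def mat_of_rows_list_def)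
  have "bounded_avoiders TYPE(nat) {cprod G1_cols (Suc 0)} (Suc 1)"
  proof (rule bounded_avoiders_cprod_Suc)
    show "bounded_avoiders TYPE(nat) {cprod G1_cols 0} 1" unfolding cprod_0 by (rule bounded_avoiders_G1)
    show "\<forall>q \<in> G1_cols. length q = 3" by (simp add: G1_cols_def)
  qed
  then show "bounded_avoiders TYPE(nat) {col_lists F14} 2" unfolding c by (simp add: numeral_2_eq_2)
  show "q \<in> col_lists F14 \<or> map Not q \<in> col_lists F14"
    if "length q = Suc (Suc 2)" "length (filter id q) = (2 + 3) div 2" for q
    unfolding c
  proof (rule cprod_balanced)
    fix u :: "bool list" assume "length u = 3" "2 \<le> length (filter id u) + 1" "length (filter id u) \<le> 2"
    then show "u \<in> G1_cols \<or> map Not u \<in> G1_cols" by (intro G1_cols_balanced) auto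
  qed (use that in auto)
qed

text \<open>The upper bound is obtained by induction for every \<open>t\<close>. The lower bound
  uses \<open>t \<le> 2\<close>, which keeps the number of ones in the upper four entries between 1
  and 3; for \<open>t = 3\<close> four ones could occur there, and neither that column nor its
  complement belongs to \<open>G3_cols\<close>.\<close>

lemma forb_G3_product:
  assumes "1 \<le> m" "t \<le> 2"
  shows "forb m (G3 \<otimes>\<^sub>c K t) = 2 * (\<Sum>i\<le>t + 2. (m - 1) choose i)"
proof (rule forb_eqI[OF assms(1)])
  have c: "col_lists (G3 \<otimes>\<^sub>c K t) = cprod G3_cols t"
    unfolding col_lists_product_K col_lists_G3 ..
  show "simple_mat (G3 \<otimes>\<^sub>c K t)" by (intro simple_mat_product G3_simple simple_mat_K)
  show "0 < dim_col (G3 \<otimes>\<^sub>c K t)" "dim_row (G3 \<otimes>\<^sub>c K t) = Suc (Suc (t + 2))"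
    by (simp_all add: mat_product_def G3_def K_def mat_of_rows_list_def)
  have "bounded_avoiders TYPE(nat) {cprod G3_cols t} (t + 2)"
  proof (induction t)
    case 0
    show ?case unfolding cprod_0 add_0 by (rule bounded_avoiders_G3)
  next
    case (Suc t)
    have "\<forall>q \<in> G3_cols. length q = 4" by (simp add: G3_cols_def)
    then show ?case unfolding add_Suc by (rule bounded_avoiders_cprod_Suc[OF Suc])
  qed
  then show "bounded_avoiders TYPE(nat) {col_lists (G3 \<otimes>\<^sub>c K t)} (t + 2)" unfolding c .
  show "q \<in> col_lists (G3 \<otimes>\<^sub>c K t) \<or> map Not q \<in> col_lists (G3 \<otimes>\<^sub>c K t)"
    if q: "length q = Suc (Suc (t + 2))" "length (filter id q) = (t + 2 + 3) div 2" for q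
    unfolding c
  proof (rule cprod_balanced)
    fix u :: "bool list" assume u: "length u = 4" "(t + 2 + 3) div 2 \<le> length (filter id u) + t"
      "length (filter id u) \<le> (t + 2 + 3) div 2"
    have "t = 0 \<or> t = 1 \<or> t = 2" using assms(2) by auto
    then have "1 \<le> length (filter id u) \<and> length (filter id u) \<le> 3" using u(2,3) by auto
    then show "u \<in> G3_cols \<or> map Not u \<in> G3_cols" by (intro G3_cols_balanced[OF u(1)]) auto
  qed (use q in auto)
qed

text \<open>One copy of the sum gives up its last term; what remains of it combines with the other
  copy by the summed Pascal rule.\<close>

lemma f_bound_eq:
  assumes "m \<ge> 1"
  shows "f_bound m k = ((m - 1) choose (k - 2)) + (\<Sum>i = 0..k - 2. m choose i)"
proof -
  obtain n where n: "m = Suc n" using assms by (cases m) auto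
  have "2 * (\<Sum>i\<le>d. n choose i) = (n choose d) + (\<Sum>i\<le>d. Suc n choose i)" for d
  proof (cases d)
    case (Suc e)
    then show ?thesis using sum_choose_Suc[of n e] by (simp add: algebra_simps)
  qed simp
  then show ?thesis by (simp add: f_bound_def n atLeast0AtMost)
qed

theorem theorem1p2:
  fixes m :: nat
  assumes "m \<ge> 1"
  shows "forb m F14 = f_bound m 4 \<and>
         (\<forall>k \<in> {4, 5, 6}. forb m (F3 k) = f_bound m k) \<and>
         (\<forall>k \<ge> 2. f_bound m k = ((m - 1) choose (k - 2)) + (\<Sum>i = 0..k - 2. m choose i))"
proof (intro conjI ballI allI impI)
  show "forb m F14 = f_bound m 4"
    using forb_F14[OF assms] by (simp add: f_bound_def atLeast0AtMost)
  fix k :: nat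
  show "forb m (F3 k) = f_bound m k" if "k \<in> {4, 5, 6}"
  proof -
    have k: "k - 4 \<le> 2" "k - 4 + 2 = k - 2" using that by auto
    show ?thesis
      using forb_G3_product[OF assms k(1)] unfolding k(2) F3_def f_bound_def atLeast0AtMost .
  qed
  show "f_bound m k = ((m - 1) choose (k - 2)) + (\<Sum>i = 0..k - 2. m choose i)"
    by (rule f_bound_eq[OF assms])
qed

end
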